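(* For $l\geq 0$ let $s_l$ be the cardinality of the set $\mathrm{Solp}_l$ of symplectic oriented link patterns of size $l$. Then the sequence $(s_l)_{l\ge 0}$ is determined by $s_0=1$, $s_1=3$, and $s_l=3s_{l-1}+4(l-1)s_{l-2}$ for $l\geq 2$.
   Context: A symplectic oriented link pattern (solp) of size $l$ consists of $l$ vertices $1,2,\dots,l$ together with a collection of oriented arrows between these vertices and a collection of oriented arrows with dots between these vertices, such that: (B) every vertex is touched by at most one arrow (dotted or not); (SpOr) there are no loops without dots (no undotted arrow from a vertex to itself). Loops with dots are allowed, and a dotted loop at a vertex comes in two different orientations (clockwise and counterclockwise), which are regarded as different. A loop counts as one arrow touching its vertex. $\mathrm{Solp}_l$ denotes the set of solps of size $l$. *)

theory Defs imports Main begin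

datatype orientation = Clockwise | Counterclockwise

text \<open>An \<open>Arrow i j\<close> goes from \<open>i\<close> to \<open>j\<close> and is only used for \<open>i \<noteq> j\<close>
  (see \<open>arrows_on\<close>): for a loop, source and target do not determine the orientation,
  so loops are kept apart and carry their orientation explicitly.\<close>

datatype arrow = Arrow nat nat | Loop nat orientation

fun touches :: "arrow \<Rightarrow> nat \<Rightarrow> bool" where
  "touches (Arrow i j) v \<longleftrightarrow> v = i \<or> v = j"
| "touches (Loop i c) v \<longleftrightarrow> v = i"

fun is_loop :: "arrow \<Rightarrow> bool" where
  "is_loop (Arrow i j) \<longleftrightarrow> False"
| "is_loop (Loop i c) \<longleftrightarrow> True"

definition arrows_on :: "nat \<Rightarrow> arrow set" where
  "arrows_on l = {Arrow i j |i j. i \<in> {1..l} \<and> j \<in> {1..l} \<and> i \<noteq> j}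
    \<union> {Loop i c |i c. i \<in> {1..l}}"

text \<open>A pattern is a pair \<open>(U, D)\<close> of the collection of arrows without dots and the
  collection of arrows with dots. Sets suffice for these collections, since no arrow can
  be repeated when each vertex is touched at most once. The two cardinalities are added
  because the same arrow in \<open>U\<close> and in \<open>D\<close> counts twice.\<close>

definition Solp :: "nat \<Rightarrow> (arrow set \<times> arrow set) set" where
  "Solp l = {(U, D). U \<subseteq> arrows_on l \<and> D \<subseteq> arrows_on l \<and>
     (\<forall>v\<in>{1..l}. card {a \<in> U. touches a v} + card {a \<in> D. touches a v} \<le> 1) \<and>
     (\<forall>a\<in>U. \<not> is_loop a)}"

end

theory Submission imports Defs begin

text \<open>Viewing a pattern as a set of arrows tagged with a Boolean (\<open>True\<close> if dotted) whose sets of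
  end points are pairwise disjoint, patterns make sense over any finite vertex set \<open>V\<close>. Fix a vertex
  \<open>v\<close>. It is untouched, or carries one of two dotted loops, or is joined to some other vertex \<open>w\<close> by
  one of four arrows; what remains is an arbitrary pattern on the vertices not yet used. By
  induction the number of patterns depends only on the cardinality of \<open>V\<close>.\<close>

text \<open>Elements are kept apart from their end sets \<open>S x\<close> because different
  elements may share one: opposite arrows, dotted and undotted copies, the two orientations of a
  loop. Two such elements still exclude each other.\<close>

definition packings :: "('e \<Rightarrow> 'a set) \<Rightarrow> 'e set \<Rightarrow> 'e set set" where
  "packings S E = {M. M \<subseteq> E \<and> (\<forall>x\<in>M. \<forall>y\<in>M. x \<noteq> y \<longrightarrow> S x \<inter> S y = {})}"

lemma finite_packings: "finite E \<Longrightarrow> finite (packings S E)"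
  unfolding packings_def by (rule finite_subset[of _ "Pow E"]) auto

text \<open>Disjointness allows at most one member \<open>e\<close> of a packing to contain
  \<open>v\<close>. Packings are sorted by this \<open>e\<close>, if any; deleting it leaves a
  packing of the elements disjoint from \<open>e\<close>.\<close>

lemma card_packings_branch:
  assumes fin: "finite E"
  shows "card (packings S E) = card (packings S {e\<in>E. v \<notin> S e})
    + (\<Sum>e\<in>{e\<in>E. v \<in> S e}. card (packings S {e'\<in>E. S e' \<inter> S e = {}}))"
proof -
  let ?A = "packings S {e\<in>E. v \<notin> S e}"
  let ?C = "{e\<in>E. v \<in> S e}"
  let ?R = "\<lambda>e. packings S {e'\<in>E. S e' \<inter> S e = {}}"
  let ?B = "\<lambda>e. insert e ` ?R e"
  have split: "packings S E = ?A \<union> (\<Union>e\<in>?C. ?B e)"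
  proof (intro equalityI subsetI)
    fix M assume M: "M \<in> packings S E"
    show "M \<in> ?A \<union> (\<Union>e\<in>?C. ?B e)"
    proof (cases "\<exists>e\<in>M. v \<in> S e")
      case True
      then obtain e where e: "e \<in> M" "v \<in> S e" by blast
      have "M - {e} \<in> ?R e" using M e unfolding packings_def by blast
      moreover have "M = insert e (M - {e})" using e by blast
      ultimately have "M \<in> ?B e" by (metis imageI)
      moreover have "e \<in> ?C" using M e unfolding packings_def by blast
      ultimately show ?thesis by blast
    next
      case False
      then show ?thesis using M unfolding packings_def by blast
    qed
  next
    fix M assume M: "M \<in> ?A \<union> (\<Union>e\<in>?C. ?B e)"
    then consider "M \<in> ?A" | e N where "e \<in> ?C" "N \<in> ?R e" "M = insert e N" by blast
    then show "M \<in> packings S E"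
      by cases (auto simp: packings_def)
  qed
  \<comment> \<open>Since \<open>v \<in> S e\<close>, the element \<open>e\<close> is not disjoint
    from itself. Hence adding \<open>e\<close> to \<open>N\<close> loses no information.\<close>
  have notin: "e \<notin> N" if "e \<in> ?C" "N \<in> ?R e" for e N
    using that unfolding packings_def by blast
  have disjA: "?A \<inter> (\<Union>e\<in>?C. ?B e) = {}"
    unfolding packings_def by blast
  \<comment> \<open>A common set would contain both \<open>e\<close> and \<open>e'\<close>, which
    meet in \<open>v\<close>.\<close>
  have disjB: "?B e \<inter> ?B e' = {}" if "e \<in> ?C" "e' \<in> ?C" "e \<noteq> e'" for e e'
    using that unfolding packings_def by blast
  have "inj_on (insert e) (?R e)" if "e \<in> ?C" for e
    using notin[OF that] by (intro inj_onI) (metis insert_ident)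
  then have cardB: "card (?B e) = card (?R e)" if "e \<in> ?C" for e
    using that by (simp add: card_image)
  have "card (packings S E) = card ?A + card (\<Union>e\<in>?C. ?B e)"
    unfolding split using fin by (intro card_Un_disjoint disjA) (auto intro!: finite_packings)
  also have "card (\<Union>e\<in>?C. ?B e) = (\<Sum>e\<in>?C. card (?B e))"
    using fin disjB by (intro card_UN_disjoint) (auto intro!: finite_packings)
  also have "\<dots> = (\<Sum>e\<in>?C. card (?R e))"
    using cardB by (intro sum.cong refl)
  finally show ?thesis .
qed

definition ends :: "bool \<times> arrow \<Rightarrow> nat set" where
  "ends x = {v. touches (snd x) v}"

lemma ends_simps [simp]: "ends (d, Arrow i j) = {i, j}" "ends (d, Loop i c) = {i}"
  by (auto simp: ends_def)

text \<open>Loops occur only with tag \<open>True\<close>, so condition (SpOr) is built into the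
  ground set and only (B) remains to be imposed.\<close>

definition tagged_arrows :: "nat set \<Rightarrow> (bool \<times> arrow) set" where
  "tagged_arrows V = {(d, Arrow i j) |d i j. i \<in> V \<and> j \<in> V \<and> i \<noteq> j}
    \<union> {(True, Loop i c) |i c. i \<in> V}"

lemma UNIV_orientation: "(UNIV :: orientation set) = {Clockwise, Counterclockwise}"
  using orientation.exhaust by auto

lemma finite_tagged_arrows:
  assumes "finite V"
  shows "finite (tagged_arrows V)"
proof (rule finite_subset)
  show "tagged_arrows V \<subseteq> (\<lambda>(d, i, j). (d, Arrow i j)) ` (UNIV \<times> V \<times> V)
      \<union> (\<lambda>(i, c). (True, Loop i c)) ` (V \<times> UNIV)"
    by (auto simp: tagged_arrows_def image_iff)
  show "finite ((\<lambda>(d, i, j). (d, Arrow i j)) ` (UNIV \<times> V \<times> V)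
      \<union> (\<lambda>(i, c). (True, Loop i c)) ` (V \<times> UNIV))"
    using assms by (simp add: UNIV_orientation)
qed

text \<open>This closes the recursion: after branching, the admissible arrows are again all tagged
  arrows on a smaller vertex set.\<close>

lemma tagged_arrows_disjoint:
  "{e' \<in> tagged_arrows V. ends e' \<inter> A = {}} = tagged_arrows (V - A)"
  by (auto simp: tagged_arrows_def)

abbreviation num_patterns :: "nat set \<Rightarrow> nat" where
  "num_patterns V \<equiv> card (packings ends (tagged_arrows V))"

lemma num_patterns_empty: "num_patterns {} = 1"
proof -
  have "packings ends (tagged_arrows {}) = {{}}"
    by (auto simp: packings_def tagged_arrows_def)
  then show ?thesis by simp
qed

lemma num_patterns_insert:
  assumes "finite V" "v \<notin> V"
  shows "num_patterns (insert v V) = 3 * num_patterns V + (\<Sum>w\<in>V. 4 * num_patterns (V - {w}))"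
proof -
  let ?L = "{(True, Loop v Clockwise), (True, Loop v Counterclockwise)}"
  let ?X = "\<lambda>w. {(True, Arrow v w), (False, Arrow v w), (True, Arrow w v), (False, Arrow w v)}"
  let ?f = "\<lambda>e. num_patterns (insert v V - ends e)"
  have v: "{e \<in> tagged_arrows (insert v V). v \<notin> ends e} = tagged_arrows V"
    using tagged_arrows_disjoint[of "insert v V" "{v}"] assms by simp
  have C: "{e \<in> tagged_arrows (insert v V). v \<in> ends e} = ?L \<union> (\<Union>w\<in>V. ?X w)"
  proof -
    have "c = Clockwise \<or> c = Counterclockwise" for c
      by (cases c) auto
    then show ?thesis
      using assms(2) unfolding tagged_arrows_def by auto
  qed
  have "num_patterns (insert v V) = num_patterns V + (\<Sum>e\<in>?L \<union> (\<Union>w\<in>V. ?X w). ?f e)"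
    using card_packings_branch[OF finite_tagged_arrows, of "insert v V" ends v] assms(1)
    by (simp only: v C tagged_arrows_disjoint finite_insert)
  also have "(\<Sum>e\<in>?L \<union> (\<Union>w\<in>V. ?X w). ?f e) = (\<Sum>e\<in>?L. ?f e) + (\<Sum>w\<in>V. \<Sum>e\<in>?X w. ?f e)"
  proof -
    have "(\<Sum>e\<in>?L \<union> (\<Union>w\<in>V. ?X w). ?f e) = (\<Sum>e\<in>?L. ?f e) + (\<Sum>e\<in>(\<Union>w\<in>V. ?X w). ?f e)"
      using assms by (intro sum.union_disjoint) auto
    \<comment> \<open>The sets \<open>?X w\<close> are disjoint because \<open>w\<close> is the end
      point other than \<open>v\<close>, and \<open>v \<notin> V\<close>.\<close>
    also have "(\<Sum>e\<in>(\<Union>w\<in>V. ?X w). ?f e) = (\<Sum>w\<in>V. \<Sum>e\<in>?X w. ?f e)"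
      using assms by (intro sum.UNION_disjoint) auto
    finally show ?thesis .
  qed
  also have "(\<Sum>e\<in>?L. ?f e) = 2 * num_patterns V"
    using assms(2) by simp
  also have "(\<Sum>w\<in>V. \<Sum>e\<in>?X w. ?f e) = (\<Sum>w\<in>V. 4 * num_patterns (V - {w}))"
  proof (intro sum.cong refl)
    fix w assume "w \<in> V"
    \<comment> \<open>\<open>v \<noteq> w\<close> keeps the two directions distinct, so that two
      directions times two tags give four summands.\<close>
    then have "v \<noteq> w" "insert v V - {v, w} = V - {w}" "insert v V - {w, v} = V - {w}"
      using assms(2) by auto
    then show "(\<Sum>e\<in>?X w. ?f e) = 4 * num_patterns (V - {w})"
      by simp
  qed
  finally show ?thesis by simp
qed

fun link_pattern_seq :: "nat \<Rightarrow> nat" where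
  "link_pattern_seq 0 = 1"
| "link_pattern_seq (Suc 0) = 3"
| "link_pattern_seq (Suc (Suc n)) = 3 * link_pattern_seq (Suc n) + 4 * Suc n * link_pattern_seq n"

lemma num_patterns_eq: "finite V \<Longrightarrow> num_patterns V = link_pattern_seq (card V)"
proof (induction "card V" arbitrary: V rule: link_pattern_seq.induct)
  case 1
  then show ?case by (simp add: num_patterns_empty)
next
  case 2
  then obtain v where "V = {v}" by (metis card_1_singletonE One_nat_def)
  then show ?case using num_patterns_insert[of "{}" v] by (simp add: num_patterns_empty)
next
  case (3 n)
  then obtain v W where V: "V = insert v W" "v \<notin> W" and W: "card W = Suc n" "finite W"
    by (metis card_Suc_eq finite_insert)
  \<comment> \<open>All \<open>Suc n\<close> choices of \<open>w\<close> contribute equally, which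
    yields the factor \<open>Suc n\<close>, that is \<open>l - 1\<close> for
    \<open>l = n + 2\<close>.\<close>
  have "num_patterns (W - {w}) = link_pattern_seq n" if "w \<in> W" for w
    using 3(2)[of "W - {w}"] W that by simp
  moreover have "num_patterns W = link_pattern_seq (Suc n)"
    using 3(1)[of W] W by simp
  ultimately show ?case
    using num_patterns_insert[OF W(2) V(2)] V W by (simp add: algebra_simps)
qed

text \<open>Both sides say that a point lies in at most one member. Finiteness makes
  \<open>card\<close> meaningful: an infinite set has \<open>card\<close> 0.\<close>

lemma pairwise_disjoint_iff_card_le_1:
  assumes "finite M"
  shows "(\<forall>x\<in>M. \<forall>y\<in>M. x \<noteq> y \<longrightarrow> S x \<inter> S y = {}) \<longleftrightarrow> (\<forall>v. card {x\<in>M. v \<in> S x} \<le> 1)"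
proof -
  have "card {x\<in>M. v \<in> S x} \<le> 1 \<longleftrightarrow> (\<forall>x\<in>M. \<forall>y\<in>M. v \<in> S x \<longrightarrow> v \<in> S y \<longrightarrow> x = y)" for v
    using assms card_le_Suc0_iff_eq[of "{x\<in>M. v \<in> S x}"] by auto
  then show ?thesis by blast
qed

text \<open>A pair \<open>(U, D)\<close> becomes the disjoint union of its components, with the tag
  recording the dots. An arrow in both \<open>U\<close> and \<open>D\<close> thus yields two
  elements, matching the sum of cardinalities in \<open>Solp\<close>.\<close>

lemma card_Solp: "card (Solp l) = num_patterns {1..l}"
proof -
  let ?T = "tagged_arrows {1..l}"
  let ?f = "\<lambda>(U, D). Pair False ` U \<union> Pair True ` D :: (bool \<times> arrow) set"
  let ?g = "\<lambda>M. ({a. (False, a) \<in> M}, {a. (True, a) \<in> M})"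
  have sub: "?f (U, D) \<subseteq> ?T \<longleftrightarrow>
      U \<subseteq> arrows_on l \<and> D \<subseteq> arrows_on l \<and> (\<forall>a\<in>U. \<not> is_loop a)" for U D
  proof -
    have "(False, a) \<in> ?T \<longleftrightarrow> a \<in> arrows_on l \<and> \<not> is_loop a"
      and "(True, a) \<in> ?T \<longleftrightarrow> a \<in> arrows_on l" for a
      by (cases a; auto simp: tagged_arrows_def arrows_on_def)+
    then show ?thesis by auto
  qed
  have iff: "(U, D) \<in> Solp l \<longleftrightarrow> ?f (U, D) \<in> packings ends ?T" for U D
  proof (cases "?f (U, D) \<subseteq> ?T")
    case True
    let ?M = "?f (U, D)"
    have fin: "finite ?M" using True finite_tagged_arrows finite_subset by blast
    then have finUD: "finite U" "finite D"
      by (auto simp: finite_image_iff inj_on_def)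
    have card: "card {x\<in>?M. v \<in> ends x} = card {a\<in>U. touches a v} + card {a\<in>D. touches a v}" for v
    proof -
      have "{x\<in>?M. v \<in> ends x} = Pair False ` {a\<in>U. touches a v} \<union> Pair True ` {a\<in>D. touches a v}"
        by (auto simp: ends_def)
      then show ?thesis
        using finUD by (simp add: card_Un_disjoint card_image inj_on_def disjoint_iff image_iff)
    qed
    \<comment> \<open>\<open>Solp\<close> bounds the count only at vertices in
      \<open>{1..l}\<close>, whereas disjointness concerns every natural number; elsewhere nothing
      is touched.\<close>
    have outside: "card {x\<in>?M. v \<in> ends x} \<le> 1" if "v \<notin> {1..l}" for v
    proof -
      have "ends x \<subseteq> {1..l}" if "x \<in> ?T" for x
        using that by (auto simp: tagged_arrows_def)
      then have "{x\<in>?M. v \<in> ends x} = {}" using True that by blast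
      then show ?thesis by (simp only: card.empty zero_le)
    qed
    have "?M \<in> packings ends ?T \<longleftrightarrow> (\<forall>v. card {x\<in>?M. v \<in> ends x} \<le> 1)"
      using True pairwise_disjoint_iff_card_le_1[OF fin, of ends] unfolding packings_def by blast
    also have "\<dots> \<longleftrightarrow> (\<forall>v\<in>{1..l}. card {x\<in>?M. v \<in> ends x} \<le> 1)"
      using outside by blast
    also have "\<dots> \<longleftrightarrow> (U, D) \<in> Solp l"
      unfolding card using True sub[of U D] by (auto simp: Solp_def)
    finally show ?thesis by simp
  next
    case False
    then show ?thesis using sub[of U D] by (auto simp: Solp_def packings_def)
  qed
  have fg: "?f (?g M) = M" for M
  proof -
    have "x \<in> ?f (?g M) \<longleftrightarrow> x \<in> M" for x
      by (cases x; cases "fst x") auto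
    then show ?thesis by blast
  qed
  have "bij_betw ?f (Solp l) (packings ends ?T)"
  proof (rule bij_betw_byWitness[where f' = ?g])
    show "\<forall>p\<in>Solp l. ?g (?f p) = p" by auto
    show "\<forall>M\<in>packings ends ?T. ?f (?g M) = M" using fg by blast
    show "?f ` Solp l \<subseteq> packings ends ?T" using iff by auto
    show "?g ` packings ends ?T \<subseteq> Solp l"
    proof (rule image_subsetI)
      fix M assume "M \<in> packings ends ?T"
      then show "?g M \<in> Solp l" by (subst iff) (simp only: fg)
    qed
  qed
  then show ?thesis by (rule bij_betw_same_card)
qed

theorem proposition6p4:
  fixes s :: "nat \<Rightarrow> nat"
  shows "(\<forall>l. s l = card (Solp l)) \<longleftrightarrow>
    s 0 = 1 \<and> s 1 = 3 \<and> (\<forall>l\<ge>2. s l = 3 * s (l - 1) + 4 * (l - 1) * s (l - 2))"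
proof -
  have card: "card (Solp l) = link_pattern_seq l" for l
    using num_patterns_eq[of "{1..l}"] by (simp add: card_Solp)
  have rec: "link_pattern_seq l
      = 3 * link_pattern_seq (l - 1) + 4 * (l - 1) * link_pattern_seq (l - 2)" if "l \<ge> 2" for l
    using that by (cases l rule: link_pattern_seq.cases) auto
  \<comment> \<open>Uniqueness: two initial values and the recurrence determine \<open>s\<close>,
    which gives the implication from right to left.\<close>
  have "s l = link_pattern_seq l"
    if "s 0 = 1" "s 1 = 3" and step: "\<forall>l\<ge>2. s l = 3 * s (l - 1) + 4 * (l - 1) * s (l - 2)" for l
  proof (induction l rule: link_pattern_seq.induct)
    case (3 n)
    then show ?case using step[rule_format, of "Suc (Suc n)"] by simp
  qed (use that in auto)
  then show ?thesis
    unfolding card using rec by auto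
qed

end
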